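(* Let $r\in\mathbb N$, and let $\mathcal L_{*,r}$, $\Delta_r$, $S_r$ be as described in the context. For every $X\in\mathcal L_{*,r}$ one has $$\operatorname{rank}(\Delta_rX-XS_r)\le2.$$
   Context: $\mathcal L(\mathcal H)$ denotes the bounded linear operators on a complex Hilbert space $\mathcal H$ and $\{R\}'$ the commutant of $R$. Let $T=\begin{bmatrix}A&C\\ 0&B\end{bmatrix}\in\mathcal L(\mathcal H_1\oplus\mathcal H_2)$ with $\dim\mathcal H_1=\dim\mathcal H_2=\aleph_0$. Let $\mathcal H$ be a Hilbert space with orthonormal basis $\{e_k\}_{k=1}^\infty$, $(e\otimes f)h=\langle h,f\rangle e$, and $S=\sum_{k\ge1}e_{k+1}\otimes e_k$ the simple unilateral shift. Assume $A$ is similar to $S$, and let $V:\mathcal H\to\mathcal H_1$ be bounded and invertible with $VS=AV$. Let $\mu_0\in\partial\sigma(B)$, and let $\{\mu_k\}_{k\ge1}$ be distinct nonzero complex numbers in the resolvent set of $B$ converging to $\mu_0$ (fast enough) such that $B-\mu_0I$ is similar to an operator $\widehat B=\begin{bmatrix}*&*\\ F_*&D_*\end{bmatrix}\in\mathcal L(\mathcal H\oplus\mathcal H)$, where $D_*=\sum_{k\ge1}(\mu_k-\mu_0)e_k\otimes e_k$ and $\operatorname{rank}F_*=1$; let $W:\mathcal H\oplus\mathcal H\to\mathcal H_2$ be bounded and invertible with $W\widehat B=(B-\mu_0I)W$. With $Z=V\oplus W$ put $\widehat T=Z^{-1}(T-\mu_0I)Z=\begin{bmatrix}S-\mu_0I&V^{-1}CW\\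 0&\widehat B\end{bmatrix}\in\mathcal L(\mathcal H\oplus\mathcal H\oplus\mathcal H)$, and $\mathcal L_{3,1}=\{Q_{3,1}:Q=[Q_{i,j}]_{i,j=1}^3\in\{\widehat T\}'\}\subset\mathcal L(\mathcal H)$. For $r\in\mathbb N$, $\mathcal E_{3,r}$ is the span of $e_r,e_{r+1},e_{r+2}$, $P_{\mathcal E_{3,r}}$ is the orthogonal projection onto it, $\mathcal L_{*,r}=\{P_{\mathcal E_{3,r}}Y|_{\mathcal E_{3,r}}:Y\in\mathcal L_{3,1}\}\subset\mathcal L(\mathcal E_{3,r})$, $\Delta_r=\sum_{i=1}^3\mu_{r+i-1}\,e_{r+i-1}\otimes e_{r+i-1}$ and $S_r=P_{\mathcal E_{3,r}}S|_{\mathcal E_{3,r}}=e_{r+1}\otimes e_r+e_{r+2}\otimes e_{r+1}$ on $\mathcal E_{3,r}$. *)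

theory Defs
  imports "HOL-Analysis.Analysis"
begin

section \<open>Complex Hilbert spaces\<close>

class complex_vector = real_vector +
  fixes scaleC :: "complex \<Rightarrow> 'a \<Rightarrow> 'a"  (infixr "*\<^sub>C" 75)
  assumes scaleC_add_right: "c *\<^sub>C (x + y) = c *\<^sub>C x + c *\<^sub>C y"
    and scaleC_add_left: "(c + d) *\<^sub>C x = c *\<^sub>C x + d *\<^sub>C x"
    and scaleC_scaleC: "c *\<^sub>C d *\<^sub>C x = (c * d) *\<^sub>C x"
    and scaleC_one: "1 *\<^sub>C x = x"
    and scaleR_scaleC: "r *\<^sub>R x = complex_of_real r *\<^sub>C x"

global_interpretation complex_vector:
  vector_space "scaleC :: complex \<Rightarrow> 'a \<Rightarrow> 'a :: complex_vector"
  defines cspan = complex_vector.span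
    and cdim = complex_vector.dim
  by unfold_locales
    (simp_all add: scaleC_add_right scaleC_add_left scaleC_scaleC scaleC_one)

text \<open>
  The inner product is linear in its first argument. Positivity, definiteness and the
  formula for the norm are inherited from the real inner product, which is its real part.
\<close>

class complex_inner = complex_vector + real_inner +
  fixes cinner :: "'a \<Rightarrow> 'a \<Rightarrow> complex"
  assumes cinner_commute: "cinner x y = cnj (cinner y x)"
    and cinner_add_left: "cinner (x + y) z = cinner x z + cinner y z"
    and cinner_scaleC_left: "cinner (c *\<^sub>C x) y = c * cinner x y"
    and inner_Re_cinner: "inner x y = Re (cinner x y)"

class chilbert_space = complex_inner + complete_space

lemma cinner_self: "cinner x x = complex_of_real ((norm x)\<^sup>2)"
  for x :: "'a :: complex_inner"
proof -
  have "Im (cinner x x) = - Im (cinner x x)"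
    using cinner_commute[of x x] by (metis cnj.simps(2))
  then show ?thesis
    by (simp add: complex_eq_iff power2_norm_eq_inner inner_Re_cinner)
qed

text \<open>Orthogonal direct sums are the product types.\<close>

instantiation prod :: (complex_vector, complex_vector) complex_vector
begin

definition scaleC_prod :: "complex \<Rightarrow> 'a \<times> 'b \<Rightarrow> 'a \<times> 'b"
  where "scaleC_prod c x = (c *\<^sub>C fst x, c *\<^sub>C snd x)"

instance
  by standard
    (simp_all add: scaleC_prod_def scaleC_add_right scaleC_add_left scaleC_scaleC scaleC_one
      scaleR_prod_def scaleR_scaleC)

end

instantiation prod :: (complex_inner, complex_inner) complex_inner
begin

definition cinner_prod :: "'a \<times> 'b \<Rightarrow> 'a \<times> 'b \<Rightarrow> complex"
  where "cinner_prod x y = cinner (fst x) (fst y) + cinner (snd x) (snd y)"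

instance
proof
  fix x y z :: "'a \<times> 'b" and c :: complex
  show "cinner x y = cnj (cinner y x)"
    unfolding cinner_prod_def complex_cnj_add by (metis cinner_commute)
  show "cinner (x + y) z = cinner x z + cinner y z"
    by (simp add: cinner_prod_def cinner_add_left)
  show "cinner (c *\<^sub>C x) y = c * cinner x y"
    by (simp add: cinner_prod_def scaleC_prod_def cinner_scaleC_left distrib_left)
  show "inner x y = Re (cinner x y)"
    by (simp add: cinner_prod_def inner_prod_def inner_Re_cinner)
qed

end

instance prod :: (chilbert_space, chilbert_space) chilbert_space ..

definition orthonormal_basis :: "'i set \<Rightarrow> ('i \<Rightarrow> 'a :: complex_inner) \<Rightarrow> bool"
  where "orthonormal_basis I e \<longleftrightarrow>
    (\<forall>i\<in>I. \<forall>j\<in>I. cinner (e i) (e j) = (if i = j then 1 else 0)) \<and>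
    closure (cspan (e ` I)) = UNIV"


section \<open>Bounded operators\<close>

definition bounded_clinear :: "('a :: complex_inner \<Rightarrow> 'b :: complex_inner) \<Rightarrow> bool"
  where "bounded_clinear f \<longleftrightarrow> bounded_linear f \<and> (\<forall>c x. f (c *\<^sub>C x) = c *\<^sub>C f x)"

definition invertible_op :: "('a :: complex_inner \<Rightarrow> 'b :: complex_inner) \<Rightarrow> bool"
  where "invertible_op f \<longleftrightarrow>
    bounded_clinear f \<and> (\<exists>g. bounded_clinear g \<and> g \<circ> f = id \<and> f \<circ> g = id)"

definition minus_scalar :: "('a \<Rightarrow> 'a) \<Rightarrow> complex \<Rightarrow> 'a \<Rightarrow> 'a :: complex_vector"
  where "minus_scalar R z = (\<lambda>x. R x - z *\<^sub>C x)"

definition op_spectrum :: "('a \<Rightarrow> 'a :: complex_inner) \<Rightarrow> complex set"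
  where "op_spectrum R = {z. \<not> invertible_op (minus_scalar R z)}"

definition resolvent_set :: "('a \<Rightarrow> 'a :: complex_inner) \<Rightarrow> complex set"
  where "resolvent_set R = - op_spectrum R"

definition commutant :: "('a \<Rightarrow> 'a :: complex_inner) \<Rightarrow> ('a \<Rightarrow> 'a) set"
  where "commutant R = {Q. bounded_clinear Q \<and> Q \<circ> R = R \<circ> Q}"

text \<open>
  The rank of the restriction of an operator to a subspace. The library sets the dimension
  of an infinite-dimensional space to 0, so a rank of 0 or an upper bound is
  informative only for operators of finite rank, e.g. if the subspace has finite dimension.
\<close>

definition rank_on :: "'a :: complex_vector set \<Rightarrow> ('a \<Rightarrow> 'b :: complex_vector) \<Rightarrow> nat"
  where "rank_on M f = cdim (f ` M)"

definition block_op ::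
    "('a \<Rightarrow> 'c) \<Rightarrow> ('b \<Rightarrow> 'c) \<Rightarrow> ('a \<Rightarrow> 'd) \<Rightarrow> ('b \<Rightarrow> 'd) \<Rightarrow> 'a \<times> 'b \<Rightarrow> 'c::plus \<times> 'd::plus"
  where "block_op A\<^sub>1\<^sub>1 A\<^sub>1\<^sub>2 A\<^sub>2\<^sub>1 A\<^sub>2\<^sub>2 = (\<lambda>(x, y). (A\<^sub>1\<^sub>1 x + A\<^sub>1\<^sub>2 y, A\<^sub>2\<^sub>1 x + A\<^sub>2\<^sub>2 y))"

definition entry31 :: "('a \<times> 'b::zero \<times> 'c::zero \<Rightarrow> 'd \<times> 'e \<times> 'f) \<Rightarrow> 'a \<Rightarrow> 'f"
  where "entry31 Q = (\<lambda>x. snd (snd (Q (x, 0, 0))))"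

definition rank_one :: "'b \<Rightarrow> 'a \<Rightarrow> 'a :: complex_inner \<Rightarrow> 'b :: complex_vector"  (infix "\<otimes>" 80)
  where "(e \<otimes> f) = (\<lambda>h. cinner h f *\<^sub>C e)"

text \<open>
  Both sums over \<open>k \<ge> 1\<close> are taken pointwise (convergence in the strong operator topology).
\<close>

definition unilateral_shift :: "(nat \<Rightarrow> 'a) \<Rightarrow> 'a \<Rightarrow> 'a :: complex_inner"
  where "unilateral_shift e = (\<lambda>h. \<Sum>\<^sub>\<infinity>k\<in>{1..}. (e (k + 1) \<otimes> e k) h)"

definition diagonal_op :: "(nat \<Rightarrow> 'a) \<Rightarrow> (nat \<Rightarrow> complex) \<Rightarrow> 'a \<Rightarrow> 'a :: complex_inner"
  where "diagonal_op e d = (\<lambda>h. \<Sum>\<^sub>\<infinity>k\<in>{1..}. d k *\<^sub>C (e k \<otimes> e k) h)"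


section \<open>Compressions to subspaces\<close>

text \<open>
  For a complete subspace \<open>M\<close> the point below exists and is unique.
\<close>

definition orth_proj :: "'a set \<Rightarrow> 'a \<Rightarrow> 'a :: complex_inner"
  where "orth_proj M x = (THE p. p \<in> M \<and> (\<forall>m\<in>M. cinner (x - p) m = 0))"

text \<open>
  Operators on a subspace \<open>M\<close> are extensional functions on \<open>M\<close>, so that
  distinct functions are distinct operators.
\<close>

definition compression :: "'a set \<Rightarrow> ('a \<Rightarrow> 'a) \<Rightarrow> 'a \<Rightarrow> 'a :: complex_inner"
  where "compression M Y = restrict (\<lambda>x. orth_proj M (Y x)) M"

end

theory Submission imports Defs begin

text \<open>
  Compare the (3,1) entries of \<open>Q That\<close> and \<open>That Q\<close>. For \<open>Y = Q\<^sub>3\<^sub>1\<close> this gives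
  \<open>(D + \<mu>0 I) Y - Y S = - F Q\<^sub>2\<^sub>1\<close>, which has rank at most one. Compressing to the window \<open>E\<close>
  turns \<open>D + \<mu>0 I\<close> into \<open>\<Delta>r\<close> without error because \<open>E\<close> reduces the diagonal operator, whereas
  \<open>S\<close> moves only the last basis vector of \<open>E\<close> out of \<open>E\<close>, which costs one further rank.
\<close>

subsection \<open>Complex inner products\<close>

lemma cinner_add_right: "cinner x (y + z) = cinner x y + cinner x z"
  by (subst (1 2 3) cinner_commute) (simp add: cinner_add_left)

lemma cinner_scaleC_right: "cinner x (c *\<^sub>C y) = cnj c * cinner x y"
  by (subst (1 2) cinner_commute) (simp add: cinner_scaleC_left)

lemma cinner_zero_left [simp]: "cinner 0 y = 0"
  using cinner_add_left[of 0 0 y] by simp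

lemma cinner_zero_right [simp]: "cinner x 0 = 0"
  using cinner_add_right[of x 0 0] by simp

lemma cinner_diff_left: "cinner (x - y) z = cinner x z - cinner y z"
  using cinner_add_left[of "x - y" y z] by (simp add: algebra_simps)

lemma cinner_sum_left: "cinner (\<Sum>i\<in>I. f i) z = (\<Sum>i\<in>I. cinner (f i) z)"
  by (induction I rule: infinite_finite_induct) (simp_all add: cinner_add_left)

lemma cinner_self_eq_0: "cinner x x = 0 \<Longrightarrow> x = 0"
  by (simp add: cinner_self)

text \<open>\<open>cinner x (\<i> *\<^sub>C y)\<close> is \<open>-\<i>\<close> times
  \<open>cinner x y\<close>, so its real part is the imaginary part of \<open>cinner x y\<close>.
  Continuity thus reduces to the real inner product.\<close>

lemma cinner_eq_Complex_inner: "cinner x y = Complex (inner x y) (inner x (\<i> *\<^sub>C y))"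
  by (simp add: complex_eq_iff inner_Re_cinner cinner_scaleC_right)

lemma continuous_on_cinner_left:
  assumes "continuous_on M f"
  shows "continuous_on M (\<lambda>x. cinner (f x) y)"
  unfolding cinner_eq_Complex_inner Complex_eq
  by (intro continuous_intros assms)

subsection \<open>Bounded complex-linear operators\<close>

lemma
  assumes "bounded_clinear f"
  shows bounded_clinear_bounded_linear: "bounded_linear f"
    and bounded_clinear_scaleC: "f (c *\<^sub>C x) = c *\<^sub>C f x"
  using assms by (simp_all add: bounded_clinear_def)

lemma bounded_clinearI:
  assumes "bounded_linear f" "\<And>c x. f (c *\<^sub>C x) = c *\<^sub>C f x"
  shows "bounded_clinear f"
  using assms by (simp add: bounded_clinear_def)

lemma
  assumes "bounded_clinear f"
  shows bounded_clinear_add: "f (x + y) = f x + f y"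
    and bounded_clinear_diff: "f (x - y) = f x - f y"
    and bounded_clinear_zero: "f 0 = 0"
  using bounded_clinear_bounded_linear[OF assms]
  by (simp_all add: linear_add linear_diff linear_0 bounded_linear.linear)

lemma bounded_clinear_compose:
  assumes "bounded_clinear f" "bounded_clinear g"
  shows "bounded_clinear (\<lambda>x. f (g x))"
  using assms unfolding bounded_clinear_def by (auto intro: bounded_linear_compose)

lemma bounded_clinear_snd: "bounded_clinear snd"
  by (intro bounded_clinearI bounded_linear_snd) (simp add: scaleC_prod_def)

lemma bounded_clinear_Pair_0: "bounded_clinear (\<lambda>x. (x, 0))"
  by (intro bounded_clinearI bounded_linear_Pair bounded_linear_ident bounded_linear_zero)
    (simp add: scaleC_prod_def)

lemma bounded_clinear_0_Pair: "bounded_clinear (Pair 0)"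
  by (intro bounded_clinearI bounded_linear_Pair bounded_linear_ident bounded_linear_zero)
    (simp add: scaleC_prod_def)

lemma bounded_clinear_entry31:
  assumes "bounded_clinear Q"
  shows "bounded_clinear (entry31 Q)"
proof -
  have "bounded_clinear (\<lambda>x. snd (snd (Q (x, 0))))"
    by (intro bounded_clinear_compose[OF bounded_clinear_snd] bounded_clinear_compose[OF assms]
        bounded_clinear_Pair_0)
  then show ?thesis
    by (simp add: entry31_def zero_prod_def)
qed

text \<open>Boundedness of the diagonal series will be inherited from the whole block operator by
  embedding into the second summand.\<close>

lemma bounded_clinear_block22:
  assumes "bounded_clinear (block_op A11 A12 A21 A22)" "A21 0 = 0"
  shows "bounded_clinear A22"
proof -
  have "bounded_clinear (\<lambda>y. snd (block_op A11 A12 A21 A22 (0, y)))"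
    by (intro bounded_clinear_compose[OF bounded_clinear_snd] bounded_clinear_compose[OF assms(1)]
        bounded_clinear_0_Pair)
  then show ?thesis
    by (simp add: block_op_def assms(2))
qed

lemma rank_one_range:
  assumes f: "bounded_clinear f" and "rank_on UNIV f = 1"
  obtains v where "range f \<subseteq> cspan {v}"
proof -
  obtain M where M: "range f \<subseteq> cspan M" "card M = cdim (range f)"
    using complex_vector.basis_exists[of "range f"] by metis
  \<comment> \<open>Cardinality 1 forces \<open>M\<close> to be a singleton; the default dimension 0
    of infinite-dimensional spaces cannot interfere.\<close>
  then have "card M = 1"
    using assms(2) by (simp add: rank_on_def)
  then show ?thesis
    using M(1) that by (auto simp: card_1_singleton_iff)
qed

text \<open>\<open>R\<close> is the conjugate of \<open>A\<close> by \<open>V\<close>. This is how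
  the shift, given as an infinite sum, is seen to be bounded.\<close>

lemma similar_op_linear:
  assumes V: "invertible_op V" and A: "bounded_clinear A" and eq: "V \<circ> R = A \<circ> V"
  shows "bounded_clinear R"
proof -
  obtain U where U: "bounded_clinear U" "U \<circ> V = id"
    using V by (auto simp: invertible_op_def)
  have "R = (\<lambda>x. U (A (V x)))"
    using U(2) eq by (metis comp_apply id_apply ext)
  moreover have "bounded_clinear V"
    using V by (simp add: invertible_op_def)
  ultimately show ?thesis
    using bounded_clinear_compose[OF U(1) bounded_clinear_compose[OF A]] by simp
qed

subsection \<open>Finite-dimensional compressions\<close>

text \<open>For a finite orthonormal family this is the orthogonal projection onto its span, in a
  form whose linearity is visible, unlike the description by \<open>THE\<close>.\<close>

definition fourier_sum :: "'i set \<Rightarrow> ('i \<Rightarrow> 'a) \<Rightarrow> 'a \<Rightarrow> 'a :: complex_inner"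
  where "fourier_sum I e x = (\<Sum>i\<in>I. cinner x (e i) *\<^sub>C e i)"

lemma fourier_sum_in_cspan: "fourier_sum I e x \<in> cspan (e ` I)"
  unfolding fourier_sum_def
  by (intro complex_vector.span_sum complex_vector.span_scale complex_vector.span_base imageI)

lemma fourier_sum_add: "fourier_sum I e (x + y) = fourier_sum I e x + fourier_sum I e y"
  by (simp add: fourier_sum_def cinner_add_left scaleC_add_left sum.distrib)

lemma fourier_sum_diff: "fourier_sum I e (x - y) = fourier_sum I e x - fourier_sum I e y"
  by (simp add: fourier_sum_def cinner_diff_left complex_vector.scale_left_diff_distrib
      sum_subtractf)

lemma fourier_sum_scaleC: "fourier_sum I e (c *\<^sub>C x) = c *\<^sub>C fourier_sum I e x"
  by (simp add: fourier_sum_def cinner_scaleC_left complex_vector.scale_sum_right)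

lemma cinner_fourier_sum:
  assumes "finite I" "I \<subseteq> J" "k \<in> I" and e: "orthonormal_basis J e"
  shows "cinner (fourier_sum I e x) (e k) = cinner x (e k)"
proof -
  have "cinner (fourier_sum I e x) (e k) = (\<Sum>i\<in>I. cinner x (e i) * cinner (e i) (e k))"
    by (simp add: fourier_sum_def cinner_sum_left cinner_scaleC_left)
  also have "\<dots> = (\<Sum>i\<in>I. if i = k then cinner x (e i) else 0)"
    using e assms(2,3) by (intro sum.cong) (auto simp: orthonormal_basis_def subset_iff)
  also have "\<dots> = cinner x (e k)"
    using assms by simp
  finally show ?thesis .
qed

lemma orth_proj_cspan:
  assumes "finite I" "I \<subseteq> J" and e: "orthonormal_basis J e"
  shows "orth_proj (cspan (e ` I)) x = fourier_sum I e x"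
  unfolding orth_proj_def
proof (rule the_equality, safe)
  have *: "cinner y m = 0" if m: "m \<in> cspan (e ` I)" and y: "\<And>i. i \<in> I \<Longrightarrow> cinner y (e i) = 0" for y m
  proof -
    have "complex_vector.subspace {m. cinner y m = 0}"
      by (simp add: complex_vector.subspace_def cinner_add_right cinner_scaleC_right)
    then show ?thesis
      using complex_vector.span_minimal[of "e ` I" "{m. cinner y m = 0}"] m y by auto
  qed
  show "fourier_sum I e x \<in> cspan (e ` I)"
    by (rule fourier_sum_in_cspan)
  show orth: "cinner (x - fourier_sum I e x) m = 0" if "m \<in> cspan (e ` I)" for m
    using that by (rule *) (simp add: cinner_diff_left cinner_fourier_sum[OF assms(1,2) _ e])
  fix p assume p: "p \<in> cspan (e ` I)" "\<forall>m\<in>cspan (e ` I). cinner (x - p) m = 0"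
  let ?d = "p - fourier_sum I e x"
  have d: "?d \<in> cspan (e ` I)"
    by (intro complex_vector.span_diff p(1) fourier_sum_in_cspan)
  \<comment> \<open>\<open>?d\<close> is a difference of two residuals orthogonal to the span and
    lies in the span itself, so it is orthogonal to itself.\<close>
  have "cinner ?d ?d = cinner (x - fourier_sum I e x) ?d - cinner (x - p) ?d"
    by (simp add: cinner_diff_left)
  then show "p = fourier_sum I e x"
    using orth[OF d] p(2) d cinner_self_eq_0[of ?d] by simp
qed

text \<open>The set of good \<open>x\<close> is a closed subspace containing the basis, whose span
  is dense. Allowing \<open>u\<close> and \<open>v\<close> to differ lets the lemma test adjoint
  relations.\<close>

lemma cinner_eqI_on_basis:
  assumes e: "orthonormal_basis I e" and f: "bounded_clinear f" and g: "bounded_clinear g"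
    and eq: "\<And>j. j \<in> I \<Longrightarrow> cinner (f (e j)) u = cinner (g (e j)) v"
  shows "cinner (f x) u = cinner (g x) v"
proof -
  let ?M = "{x. cinner (f x) u = cinner (g x) v}"
  have "complex_vector.subspace ?M"
    by (simp add: complex_vector.subspace_def cinner_add_left cinner_scaleC_left
        bounded_clinear_add bounded_clinear_scaleC bounded_clinear_zero f g)
  then have "cspan (e ` I) \<subseteq> ?M"
    using eq by (intro complex_vector.span_minimal) auto
  moreover have "closed ?M"
    by (intro closed_Collect_eq continuous_on_cinner_left linear_continuous_on
        bounded_clinear_bounded_linear f g)
  ultimately have "closure (cspan (e ` I)) \<subseteq> ?M"
    by (rule closure_minimal)
  then show ?thesis
    using e by (auto simp: orthonormal_basis_def)
qed

subsection \<open>Shift and diagonal operators\<close>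

lemma infsum_eq_single:
  fixes f :: "'i \<Rightarrow> 'a :: {comm_monoid_add, t2_space}"
  assumes "k \<in> I" "\<And>j. j \<in> I \<Longrightarrow> j \<noteq> k \<Longrightarrow> f j = 0"
  shows "infsum f I = f k"
proof -
  have "infsum f I = infsum f {k}"
    using assms by (intro infsum_cong_neutral) auto
  then show ?thesis
    by simp
qed

lemma unilateral_shift_basis:
  assumes "orthonormal_basis {1..} e" "k \<ge> 1"
  shows "unilateral_shift e (e k) = e (k + 1)"
proof -
  have "unilateral_shift e (e k) = (e (k + 1) \<otimes> e k) (e k)"
    unfolding unilateral_shift_def using assms
    by (intro infsum_eq_single) (auto simp: rank_one_def orthonormal_basis_def)
  then show ?thesis
    using assms by (simp add: rank_one_def orthonormal_basis_def scaleC_one)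
qed

lemma diagonal_op_basis:
  assumes "orthonormal_basis {1..} e" "k \<ge> 1"
  shows "diagonal_op e d (e k) = d k *\<^sub>C e k"
proof -
  have "diagonal_op e d (e k) = d k *\<^sub>C (e k \<otimes> e k) (e k)"
    unfolding diagonal_op_def using assms
    by (intro infsum_eq_single) (auto simp: rank_one_def orthonormal_basis_def)
  then show ?thesis
    using assms by (simp add: rank_one_def orthonormal_basis_def scaleC_one)
qed

text \<open>
  Boundedness of the operator replaces a proof that the sum defining \<^const>\<open>diagonal_op\<close>
  converges, which can fail for unbounded \<open>d\<close>: both sides are continuous and linear in \<open>x\<close>,
  and agree on the basis.
\<close>

lemma cinner_diagonal_op:
  assumes e: "orthonormal_basis {1..} e" and D: "bounded_clinear (diagonal_op e d)" and k: "k \<ge> 1"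
  shows "cinner (diagonal_op e d x) (e k) = d k * cinner x (e k)"
proof -
  have "cinner (diagonal_op e d x) (e k) = cinner x (cnj (d k) *\<^sub>C e k)"
  proof (rule cinner_eqI_on_basis[OF e D])
    show "bounded_clinear (\<lambda>x :: 'a. x)"
      by (intro bounded_clinearI bounded_linear_ident) simp
    show "cinner (diagonal_op e d (e j)) (e k) = cinner (e j) (cnj (d k) *\<^sub>C e k)"
      if "j \<in> {1..}" for j
      using that e k
      by (auto simp: diagonal_op_basis cinner_scaleC_left cinner_scaleC_right orthonormal_basis_def)
  qed
  then show ?thesis
    by (simp add: cinner_scaleC_right)
qed

text \<open>Both sides are linear in \<open>x\<close>, and among the basis vectors of the window
  only \<open>e n\<close> is sent outside.\<close>

lemma fourier_sum_unilateral_shift: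
  assumes e: "orthonormal_basis {1..} e" and S: "bounded_clinear (unilateral_shift e)"
    and mn: "1 \<le> m" "m \<le> n" and x: "x \<in> cspan (e ` {m..n})"
  shows "fourier_sum {m..n} e (unilateral_shift e x) =
    unilateral_shift e x - cinner x (e n) *\<^sub>C e (n + 1)"
    (is "?l x = ?r x")
proof -
  have on: "cinner (e i) (e j) = (if i = j then 1 else 0)" if "1 \<le> i" "1 \<le> j" for i j
    using e that by (simp add: orthonormal_basis_def)
  have "complex_vector.subspace {x. ?l x = ?r x}"
    by (auto simp: complex_vector.subspace_def bounded_clinear_add[OF S] bounded_clinear_zero[OF S]
        bounded_clinear_scaleC[OF S] fourier_sum_add fourier_sum_scaleC cinner_add_left
        cinner_scaleC_left complex_vector.scale_left_distrib complex_vector.scale_right_diff_distrib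
        fourier_sum_def[of _ _ 0])
  moreover have "?l (e k) = ?r (e k)" if k: "k \<in> {m..n}" for k
  proof -
    \<comment> \<open>Only the index \<open>k + 1\<close> can contribute; for \<open>k = n\<close>
      it is outside the range and the sum is 0.\<close>
    have "?l (e k) = (\<Sum>i\<in>{m..n}. if i = k + 1 then e i else 0)"
      unfolding fourier_sum_def using k mn
      by (intro sum.cong) (auto simp: unilateral_shift_basis[OF e] on scaleC_one)
    also have "\<dots> = ?r (e k)"
      using k mn by (cases "k = n") (auto simp: unilateral_shift_basis[OF e] on scaleC_one)
    finally show ?thesis .
  qed
  ultimately have "cspan (e ` {m..n}) \<subseteq> {x. ?l x = ?r x}"
    by (intro complex_vector.span_minimal) blast+
  then show ?thesis
    using x by blast
qed

subsection \<open>The rank estimate\<close>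

text \<open>Rather than computing \<open>inv Z\<close>, the image of \<open>Z (x, q)\<close> is
  exhibited as \<open>Z\<close> of the claimed vector, and injectivity of \<open>Z\<close> cancels.
  \<open>G\<close> is \<open>C\<close> conjugated by the inverse of \<open>V\<close> and by
  \<open>W\<close>.\<close>

lemma conjugated_triangular_op:
  assumes V: "invertible_op V" and W: "invertible_op W"
    and VS: "V \<circ> S = A \<circ> V" and WB: "W \<circ> Bh = minus_scalar B z \<circ> W"
    and C: "C 0 = 0" and Z: "Z = block_op V (\<lambda>_. 0) (\<lambda>_. 0) W"
  obtains G where "G 0 = 0" "\<And>x q. (inv Z \<circ> minus_scalar (block_op A C (\<lambda>_. 0) B) z \<circ> Z) (x, q) =
    (S x - z *\<^sub>C x + G q, Bh q)"
proof -
  obtain U where U: "\<And>x. U (V x) = x" "\<And>x. V (U x) = x"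
    using V by (auto simp: invertible_op_def fun_eq_iff)
  obtain U' where U': "\<And>x. U' (W x) = x"
    using W by (auto simp: invertible_op_def fun_eq_iff)
  have V': "bounded_clinear V"
    using V by (simp add: invertible_op_def)
  have "U (C (W 0)) = 0"
    using U(1)[of 0] V' W C by (simp add: invertible_op_def bounded_clinear_zero)
  moreover have "inj Z"
    by (rule injI) (auto simp: Z block_op_def, (metis U(1) U')+)
  moreover have "minus_scalar (block_op A C (\<lambda>_. 0) B) z (Z (x, q)) =
      Z (S x - z *\<^sub>C x + U (C (W q)), Bh q)" for x q
    using fun_cong[OF VS, of x] fun_cong[OF WB, of q]
    by (simp add: Z block_op_def minus_scalar_def scaleC_prod_def U bounded_clinear_add[OF V']
        bounded_clinear_diff[OF V'] bounded_clinear_scaleC[OF V'] algebra_simps)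
  ultimately show ?thesis
    by (intro that[of "\<lambda>q. U (C (W q))"]) simp_all
qed

lemma commutant_entry31:
  assumes Q: "Q \<in> commutant R" and R: "\<And>x q. R (x, q) = (S x - z *\<^sub>C x + G q, block_op B11 B12 F D q)"
    and G: "G 0 = 0" and B0: "block_op B11 B12 F D 0 = 0"
  shows "entry31 Q (S x) = F (fst (snd (Q (x, 0)))) + D (entry31 Q x) + z *\<^sub>C entry31 Q x"
proof -
  have lin: "bounded_clinear Q" and comm: "Q (R (x, 0)) = R (Q (x, 0))"
    using Q by (simp_all add: commutant_def) (metis comp_apply)
  note lin_Y = bounded_clinear_entry31[OF lin]
  have "entry31 Q (S x) - z *\<^sub>C entry31 Q x = entry31 Q (S x - z *\<^sub>C x)"
    by (simp add: bounded_clinear_diff[OF lin_Y] bounded_clinear_scaleC[OF lin_Y])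
  \<comment> \<open>\<open>G\<close> and the lower block vanish at 0, so \<open>R (x, 0)\<close>
    stays in the first summand.\<close>
  also have "\<dots> = snd (snd (Q (R (x, 0))))"
    by (simp add: R G B0 entry31_def zero_prod_def[symmetric])
  also have "\<dots> = F (fst (snd (Q (x, 0)))) + D (entry31 Q x)"
    unfolding comm by (cases "Q (x, 0)") (auto simp: R block_op_def entry31_def zero_prod_def)
  finally show ?thesis
    by (simp add: algebra_simps)
qed

theorem proposition9:
  fixes A :: "'h1 \<Rightarrow> 'h1 :: chilbert_space"
    and B :: "'h2 \<Rightarrow> 'h2 :: chilbert_space"
    and C :: "'h2 \<Rightarrow> 'h1"
    and T :: "'h1 \<times> 'h2 \<Rightarrow> 'h1 \<times> 'h2"
    and e :: "nat \<Rightarrow> 'h :: chilbert_space"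
    and S :: "'h \<Rightarrow> 'h"
    and V :: "'h \<Rightarrow> 'h1"
    and \<mu>0 :: complex
    and \<mu> :: "nat \<Rightarrow> complex"
    and B11 B12 F D :: "'h \<Rightarrow> 'h"
    and Bhat :: "'h \<times> 'h \<Rightarrow> 'h \<times> 'h"
    and W :: "'h \<times> 'h \<Rightarrow> 'h2"
    and Z :: "'h \<times> 'h \<times> 'h \<Rightarrow> 'h1 \<times> 'h2"
    and That :: "'h \<times> 'h \<times> 'h \<Rightarrow> 'h \<times> 'h \<times> 'h"
    and L31 Lr :: "('h \<Rightarrow> 'h) set"
    and r :: nat
    and E :: "'h set"
    and \<Delta>r Sr X :: "'h \<Rightarrow> 'h"
  assumes dim_H1: "\<exists>f :: nat \<Rightarrow> 'h1. orthonormal_basis UNIV f"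
    and dim_H2: "\<exists>f :: nat \<Rightarrow> 'h2. orthonormal_basis UNIV f"
    and A: "bounded_clinear A"
    and B: "bounded_clinear B"
    and C: "bounded_clinear C"
    and T: "T = block_op A C (\<lambda>_. 0) B"
    and e: "orthonormal_basis {1..} e"
    and S: "S = unilateral_shift e"
    and V: "invertible_op V"
    and V_S: "V \<circ> S = A \<circ> V"
    and \<mu>0: "\<mu>0 \<in> frontier (op_spectrum B)"
    and \<mu>_distinct: "inj_on \<mu> {1..}"
    and \<mu>_nonzero: "\<And>k. k \<ge> 1 \<Longrightarrow> \<mu> k \<noteq> 0"
    and \<mu>_resolvent: "\<And>k. k \<ge> 1 \<Longrightarrow> \<mu> k \<in> resolvent_set B"
    and \<mu>_lim: "\<mu> \<longlonglongrightarrow> \<mu>0"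
    and B11: "bounded_clinear B11"
    and B12: "bounded_clinear B12"
    and F: "bounded_clinear F"
    and F_rank: "rank_on UNIV F = 1"
    and D: "D = diagonal_op e (\<lambda>k. \<mu> k - \<mu>0)"
    and Bhat: "bounded_clinear Bhat"
    and Bhat_block: "Bhat = block_op B11 B12 F D"
    and W: "invertible_op W"
    and W_Bhat: "W \<circ> Bhat = minus_scalar B \<mu>0 \<circ> W"
    and Z: "Z = block_op V (\<lambda>_. 0) (\<lambda>_. 0) W"
    and That: "That = inv Z \<circ> minus_scalar T \<mu>0 \<circ> Z"
    and L31: "L31 = entry31 ` commutant That"
    and r: "r \<ge> 1"
    and E: "E = cspan {e r, e (r + 1), e (r + 2)}"
    and Lr: "Lr = compression E ` L31"
    and \<Delta>r: "\<Delta>r = restrict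
      (\<lambda>x. \<Sum>i = 1..3. \<mu> (r + i - 1) *\<^sub>C (e (r + i - 1) \<otimes> e (r + i - 1)) x) E"
    and Sr: "Sr = compression E S"
    and X: "X \<in> Lr"
  shows "rank_on E (\<lambda>x. \<Delta>r (X x) - X (Sr x)) \<le> 2"
proof -
  let ?I = "{r..r + 2}" and ?P = "fourier_sum {r..r + 2} e"
  have I: "finite ?I" "?I \<subseteq> {1..}"
    using r by auto
  have "{r..r + 2} = {r, r + 1, r + 2}"
    by auto
  then have E': "E = cspan (e ` ?I)"
    by (simp add: E)
  have proj: "orth_proj E y = ?P y" for y
    unfolding E' by (rule orth_proj_cspan[OF I e])
  have P_E: "?P y \<in> E" for y
    unfolding E' by (rule fourier_sum_in_cspan)

  have lin_S: "bounded_clinear S"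
    by (rule similar_op_linear[OF V A V_S])
  have lin_D: "bounded_clinear D"
    by (rule bounded_clinear_block22[OF Bhat[unfolded Bhat_block] bounded_clinear_zero[OF F]])
  obtain v where v: "range F \<subseteq> cspan {v}"
    using rank_one_range[OF F F_rank] .
  obtain Q where Q: "Q \<in> commutant That" and X_eq: "X = compression E (entry31 Q)"
    using X by (auto simp: Lr L31)
  let ?Y = "entry31 Q"
  have lin_Y: "bounded_clinear ?Y"
    using Q by (intro bounded_clinear_entry31) (simp add: commutant_def)
  obtain G where G: "G 0 = 0" and That_eq: "\<And>x q. That (x, q) = (S x - \<mu>0 *\<^sub>C x + G q, Bhat q)"
    unfolding That T
    by (rule conjugated_triangular_op[where C = C, OF V W V_S W_Bhat bounded_clinear_zero[OF C] Z]) blast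
  have intertwine: "?Y (S x) = F (fst (snd (Q (x, 0)))) + D (?Y x) + \<mu>0 *\<^sub>C ?Y x" for x
    using commutant_entry31[OF Q That_eq[unfolded Bhat_block] G]
      bounded_clinear_zero[OF Bhat, unfolded Bhat_block] .

  \<comment> \<open>\<open>D\<close> has entries \<open>\<mu> k - \<mu>0\<close>, and adding
    \<open>\<mu>0\<close> restores those of \<open>\<Delta>r\<close>. As \<open>\<Delta>r\<close> is
    extensional on \<open>E\<close>, evaluating it uses \<open>P_E\<close>.\<close>
  have diag: "\<Delta>r (?P y) = ?P (D y + \<mu>0 *\<^sub>C y)" for y
  proof -
    have "\<Delta>r (?P y) = (\<Sum>i = 1..3. \<mu> (r + i - 1) *\<^sub>C cinner (?P y) (e (r + i - 1)) *\<^sub>C e (r + i - 1))"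
      using P_E by (simp add: \<Delta>r rank_one_def)
    also have "\<dots> = (\<Sum>k\<in>?I. \<mu> k *\<^sub>C cinner (?P y) (e k) *\<^sub>C e k)"
      by (rule sum.reindex_bij_witness[of _ "\<lambda>k. k + 1 - r" "\<lambda>i. r + i - 1"]) auto
    also have "\<dots> = ?P (D y + \<mu>0 *\<^sub>C y)"
      unfolding fourier_sum_def[of _ _ "D y + \<mu>0 *\<^sub>C y"]
    proof (intro sum.cong refl)
      fix k assume k: "k \<in> ?I"
      then have "cinner (D y) (e k) = (\<mu> k - \<mu>0) * cinner y (e k)"
        unfolding D using r by (intro cinner_diagonal_op e lin_D[unfolded D]) auto
      then have "cinner (D y + \<mu>0 *\<^sub>C y) (e k) = \<mu> k * cinner y (e k)"
        by (simp add: cinner_add_left cinner_scaleC_left algebra_simps)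
      then show "\<mu> k *\<^sub>C cinner (?P y) (e k) *\<^sub>C e k = cinner (D y + \<mu>0 *\<^sub>C y) (e k) *\<^sub>C e k"
        using cinner_fourier_sum[OF I k e] by (simp add: scaleC_scaleC)
    qed
    finally show ?thesis .
  qed

  \<comment> \<open>Neither spanning vector depends on \<open>x\<close>: the first comes from the
    rank-one \<open>F\<close>, the second from the basis vector that the shift pushes out of the
    window.\<close>
  have "\<Delta>r (X x) - X (Sr x) \<in> cspan {?P v, ?P (?Y (e (r + 3)))}" if x: "x \<in> E" for x
  proof -
    define c where "c = cinner x (e (r + 2))"
    obtain t where t: "F (fst (snd (Q (x, 0)))) = t *\<^sub>C v"
      using v by (auto simp: complex_vector.span_singleton)
    have "?P (S x) = S x - c *\<^sub>C e (r + 3)"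
      using fourier_sum_unilateral_shift[OF e lin_S[unfolded S] r, of "r + 2" x] x
      by (simp add: S E' c_def numeral_eq_Suc)
    \<comment> \<open>\<open>Sr x\<close> is \<open>?P (S x)\<close>, which lies in
      \<open>E\<close>, so the extensional \<open>X\<close> acts on it as the compression of
      \<open>?Y\<close>.\<close>
    then have "X (Sr x) = ?P (?Y (S x - c *\<^sub>C e (r + 3)))"
      using x P_E[of "S x"] by (simp add: X_eq Sr compression_def proj)
    also have "\<dots> = ?P (t *\<^sub>C v + (D (?Y x) + \<mu>0 *\<^sub>C ?Y x)) - c *\<^sub>C ?P (?Y (e (r + 3)))"
      by (simp add: bounded_clinear_diff[OF lin_Y] bounded_clinear_scaleC[OF lin_Y] intertwine t
          fourier_sum_diff fourier_sum_scaleC add.assoc)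
    \<comment> \<open>By \<open>diag\<close> the projected term
      \<open>D (?Y x) + \<mu>0 *\<^sub>C ?Y x\<close> occurs in both products and cancels.\<close>
    finally have "\<Delta>r (X x) - X (Sr x) = c *\<^sub>C ?P (?Y (e (r + 3))) - t *\<^sub>C ?P v"
      using x diag[of "?Y x"]
      by (simp add: X_eq compression_def proj fourier_sum_add fourier_sum_scaleC)
    then show ?thesis
      by (auto intro: complex_vector.span_diff complex_vector.span_scale complex_vector.span_base)
  qed
  \<comment> \<open>The image lies in the span of a finite set, so the bound concerns a true
    dimension and not the default 0.\<close>
  then have "rank_on E (\<lambda>x. \<Delta>r (X x) - X (Sr x)) \<le> card {?P v, ?P (?Y (e (r + 3)))}"
    unfolding rank_on_def by (intro complex_vector.dim_le_card) auto
  also have "\<dots> \<le> 2"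
    by (simp add: card_insert_if)
  finally show ?thesis .
qed

end
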